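(* Let $(X,\mu)$ be a bounded valency ternary algebra. The following are equivalent: (1) $(X,\mu)$ is a coarse median algebra; (2) $(X,d_\mu,\mu)$ is a coarse median space (in particular the induced function $d_\mu$ is a well-defined metric on $X$); (3) there exists a metric $d$ on $X$ such that $(X,d,\mu)$ is a bounded geometry coarse median space.
   Context: A ternary algebra $(X,\mu)$ is a set $X$ with a function $\mu:X^3\to X$. For $a,b\in X$ the interval is $[a,b]=\{\mu(a,x,b)\mid x\in X\}$; $\sharp A$ denotes cardinality. $(X,\mu)$ has finite intervals if every $[a,b]$ is finite. Bounded valency: there is a function $\phi:\mathbb R^+\to\mathbb R^+$ (where $\mathbb R^+=[0,\infty)$) such that for all $x\in X$ and all $R$, $\sharp\{y\in X\mid \sharp[x,y]\le R\}\le\phi(R)$. Coarse median algebra: a ternary algebra $(X,\mu)$ with finite intervals such that (M1) $\mu(a,a,b)=a$ for all $a,b$; (M2) $\mu(a,b,c)=\mu(a,c,b)=\mu(b,a,c)$ for all $a,b,c$; (M3)' there is a constant $K\ge 0$ such that for all $a,b,c,d,e\in X$ the interval $[\mu(a,b,\mu(c,d,e)),\,\mu(\mu(a,b,c),\mu(a,b,d),e)]$ has cardinality at most $K$. Induced function: $d_\mu(a,b)=\min\{\sum_{i=1}^n(\sharp[x_{i-1},x_i]-1): a=x_0,\ldots,x_n=b,\ x_i\in X,\ n\in\mathbb N\}$. It is defined when any two points can be joined by a finite chain $x_0,\dots,x_n$ with all intervals $[x_{i-1},x_i]$ finite. Coarse median space: a triple $(X,d,\mu)$ with $(X,d)$ a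 metric space and $\mu$ a ternary operator satisfying (M1), (M2) and: (C1) there is an affine function $\rho:[0,\infty)\to[0,\infty)$ with $d(\mu(a,b,c),\mu(a',b,c))\le\rho(d(a,a'))$ for all $a,a',b,c\in X$; (C2) there is a constant $\kappa_4>0$ with $d(\mu(\mu(a,b,c),b,d),\mu(a,b,\mu(c,b,d)))\le\kappa_4$ for all $a,b,c,d\in X$. (This is known to be equivalent to Bowditch's original definition.) Bounded geometry of a metric space: for every $r>0$ there is $n\in\mathbb N$ such that every ball $B(x,r)$ has at most $n$ points. *)

theory Defs
  imports "HOL-Analysis.Abstract_Metric_Spaces"
begin

text \<open>
  The underlying set of a ternary algebra is a carrier \<open>X :: 'a set\<close> (possibly empty); the values
  of \<open>\<mu>\<close> and of metrics off the carrier play no role.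
\<close>

locale ternary_algebra =
  fixes X :: "'a set" and \<mu> :: "'a \<Rightarrow> 'a \<Rightarrow> 'a \<Rightarrow> 'a"
  assumes closed: "\<lbrakk>a \<in> X; b \<in> X; c \<in> X\<rbrakk> \<Longrightarrow> \<mu> a b c \<in> X"

definition med_interval :: "'a set \<Rightarrow> ('a \<Rightarrow> 'a \<Rightarrow> 'a \<Rightarrow> 'a) \<Rightarrow> 'a \<Rightarrow> 'a \<Rightarrow> 'a set" where
  "med_interval X \<mu> a b = {\<mu> a x b | x. x \<in> X}"

text \<open>
  Since \<open>card\<close> is \<open>0\<close> on infinite sets, the bound \<open>\<sharp>A \<le> r\<close> must include finiteness of \<open>A\<close>.
\<close>

definition card_at_most :: "'b set \<Rightarrow> real \<Rightarrow> bool" where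
  "card_at_most A r \<longleftrightarrow> finite A \<and> real (card A) \<le> r"

definition finite_intervals :: "'a set \<Rightarrow> ('a \<Rightarrow> 'a \<Rightarrow> 'a \<Rightarrow> 'a) \<Rightarrow> bool" where
  "finite_intervals X \<mu> \<longleftrightarrow> (\<forall>a\<in>X. \<forall>b\<in>X. finite (med_interval X \<mu> a b))"

definition bounded_valency :: "'a set \<Rightarrow> ('a \<Rightarrow> 'a \<Rightarrow> 'a \<Rightarrow> 'a) \<Rightarrow> bool" where
  "bounded_valency X \<mu> \<longleftrightarrow>
     (\<exists>\<phi> :: real \<Rightarrow> real. (\<forall>R\<ge>0. \<phi> R \<ge> 0) \<and>
        (\<forall>x\<in>X. \<forall>R\<ge>0. card_at_most {y \<in> X. card_at_most (med_interval X \<mu> x y) R} (\<phi> R)))"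

locale symmetric_ternary_algebra = ternary_algebra +
  assumes M1: "\<lbrakk>a \<in> X; b \<in> X\<rbrakk> \<Longrightarrow> \<mu> a a b = a"
    and M2: "\<lbrakk>a \<in> X; b \<in> X; c \<in> X\<rbrakk> \<Longrightarrow> \<mu> a b c = \<mu> a c b \<and> \<mu> a b c = \<mu> b a c"

locale coarse_median_algebra = symmetric_ternary_algebra +
  assumes finite_intervals: "finite_intervals X \<mu>"
    and M3': "\<exists>K\<ge>0. \<forall>a\<in>X. \<forall>b\<in>X. \<forall>c\<in>X. \<forall>d\<in>X. \<forall>e\<in>X.
      card_at_most (med_interval X \<mu> (\<mu> a b (\<mu> c d e)) (\<mu> (\<mu> a b c) (\<mu> a b d) e)) K"

definition interval_chain ::
  "'a set \<Rightarrow> ('a \<Rightarrow> 'a \<Rightarrow> 'a \<Rightarrow> 'a) \<Rightarrow> 'a \<Rightarrow> 'a \<Rightarrow> nat \<Rightarrow> (nat \<Rightarrow> 'a) \<Rightarrow> bool" where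
  "interval_chain X \<mu> a b n x \<longleftrightarrow> x 0 = a \<and> x n = b \<and> (\<forall>i\<le>n. x i \<in> X) \<and>
     (\<forall>i\<in>{1..n}. finite (med_interval X \<mu> (x (i - 1)) (x i)))"

definition induced_dist_defined :: "'a set \<Rightarrow> ('a \<Rightarrow> 'a \<Rightarrow> 'a \<Rightarrow> 'a) \<Rightarrow> bool" where
  "induced_dist_defined X \<mu> \<longleftrightarrow> (\<forall>a\<in>X. \<forall>b\<in>X. \<exists>n x. interval_chain X \<mu> a b n x)"

text \<open>
  Chains using an infinite interval would contribute \<open>\<infinity>\<close> to the minimum and are left out. Intervals
  between points of \<open>X\<close> are nonempty, so the subtraction on \<open>nat\<close> does not truncate. The value off
  the carrier is \<open>0\<close> because \<^locale>\<open>Metric_space\<close> asks for nonnegativity and symmetry on the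
  whole type. If \<open>a\<close> and \<open>b\<close> are not joined by a chain the value is unspecified;
  \<^const>\<open>induced_dist_defined\<close> excludes this.
\<close>

definition induced_dist :: "'a set \<Rightarrow> ('a \<Rightarrow> 'a \<Rightarrow> 'a \<Rightarrow> 'a) \<Rightarrow> 'a \<Rightarrow> 'a \<Rightarrow> real" where
  "induced_dist X \<mu> a b =
     (if a \<in> X \<and> b \<in> X
      then real (LEAST s. \<exists>n x. interval_chain X \<mu> a b n x \<and>
                   s = (\<Sum>i=1..n. (card (med_interval X \<mu> (x (i - 1)) (x i)) - 1)))
      else 0)"

locale coarse_median_space = Metric_space X d + symmetric_ternary_algebra X \<mu>
  for X :: "'a set" and d :: "'a \<Rightarrow> 'a \<Rightarrow> real" and \<mu> :: "'a \<Rightarrow> 'a \<Rightarrow> 'a \<Rightarrow> 'a" +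
  assumes C1: "\<exists>\<rho> :: real \<Rightarrow> real. (\<exists>p q. \<forall>t\<ge>0. \<rho> t = p * t + q) \<and> (\<forall>t\<ge>0. \<rho> t \<ge> 0) \<and>
      (\<forall>a\<in>X. \<forall>a'\<in>X. \<forall>b\<in>X. \<forall>c\<in>X. d (\<mu> a b c) (\<mu> a' b c) \<le> \<rho> (d a a'))"
    and C2: "\<exists>\<kappa>\<^sub>4>0. \<forall>a\<in>X. \<forall>b\<in>X. \<forall>c\<in>X. \<forall>e\<in>X.
      d (\<mu> (\<mu> a b c) b e) (\<mu> a b (\<mu> c b e)) \<le> \<kappa>\<^sub>4"

locale bounded_geometry_space = Metric_space +
  assumes bounded_geometry: "\<forall>r>0. \<exists>n::nat. \<forall>x\<in>M. finite (mball x r) \<and> card (mball x r) \<le> n"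

end

theory Submission
  imports Defs
begin

text \<open>
  The three conditions are proved in the cycle (1), (2), (3), (1).

  From (1) to (2), the point is that the induced distance sees cardinalities of intervals, and that
  translations \<open>a \<mapsto> \<mu> a b c\<close> enlarge these at most by a constant factor. By (M3)', every point of
  the interval from \<open>\<mu> a b c\<close> to \<open>\<mu> a' b c\<close> is joined by an interval of at most \<open>K\<close> elements to a point
  \<open>\<mu> b c w\<close> with \<open>w\<close> in the interval from \<open>a\<close> to \<open>a'\<close>, and bounded valency leaves at most \<open>\<phi> K\<close>
  points for each \<open>w\<close> (\<open>card_translated_interval\<close>). Translating a chain step by step gives the affine
  control (C1), in fact a Lipschitz bound. (C2) is the instance of (M3)' in which two of the
  entries coincide.

  From (2) to (3), the induced distance itself has bounded geometry: it takes integer values,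
  so a ball of radius \<open>s + 1\<close> is covered by the valency sets of the points of the ball of radius \<open>s\<close>
  (\<open>induced_balls_bounded\<close>).

  From (3) to (1), (C1) puts the interval from \<open>a\<close> to \<open>b\<close> inside a ball about \<open>a\<close> whose radius depends only
  on the distance of \<open>a\<close> and \<open>b\<close>. With bounded geometry, intervals are finite, and (M3)'
  reduces to the claim that the two sides of the long distributive law are at bounded distance. For
  this, consider all functions from a set \<open>I\<close> to \<open>X\<close>, modulo bounded distance. By (C1) the median acts
  on the classes, and by (C2) the classes satisfy the associative law exactly
  (\<open>quotient_median_algebra\<close>). Associativity implies the long distributive law in an exact algebra
  (\<open>distributive\<close>). Applied to the classes of the five coordinate functions on
  \<open>I = X \<times> X \<times> X \<times> X \<times> X\<close>, this law says precisely that its two sides are uniformly close on \<open>X\<close>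
  (\<open>coarsely_distributive\<close>).
\<close>

section \<open>Median algebras satisfying the associative law\<close>

context symmetric_ternary_algebra
begin

lemma perm:
  assumes "a \<in> X" "b \<in> X" "c \<in> X"
  shows "\<mu> a b c = \<mu> b a c" "\<mu> a b c = \<mu> a c b"
  using M2 assms by blast+

lemma M1': "\<lbrakk>a \<in> X; b \<in> X\<rbrakk> \<Longrightarrow> \<mu> a b a = a" "\<lbrakk>a \<in> X; b \<in> X\<rbrakk> \<Longrightarrow> \<mu> b a a = a"
  using M1 M2 by metis+

end

text \<open>
  (C2) with constant zero. For fixed \<open>b\<close> it says that \<open>(x, y) \<mapsto> \<mu> x b y\<close> is associative, so that this is a
  meet operation with bottom element \<open>b\<close>.
\<close>

locale exact_median_algebra = symmetric_ternary_algebra +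
  assumes assoc: "\<lbrakk>a \<in> X; b \<in> X; c \<in> X; e \<in> X\<rbrakk> \<Longrightarrow>
    \<mu> (\<mu> a b c) b e = \<mu> a b (\<mu> c b e)"
begin

text \<open>
  The relation \<open>between a x b\<close> is the order \<open>x \<le> b\<close> of the meet semilattice based at \<open>a\<close>, and also the
  order \<open>x \<le> a\<close> of the one based at \<open>b\<close>. The proof of the distributive law plays these orders, one for
  each base point, against each other.
\<close>

definition between :: "'a \<Rightarrow> 'a \<Rightarrow> 'a \<Rightarrow> bool" where
  "between a x b \<longleftrightarrow> a \<in> X \<and> x \<in> X \<and> b \<in> X \<and> \<mu> a x b = x"

lemma between_sym: "between a x b \<Longrightarrow> between b x a"
  unfolding between_def by (metis perm)

lemma median_between:
  assumes "a \<in> X" "b \<in> X" "c \<in> X"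
  shows "between a (\<mu> a b c) b" "between a (\<mu> a b c) c" "between b (\<mu> a b c) c"
proof -
  have *: "between a (\<mu> a b c) b" if "a \<in> X" "b \<in> X" "c \<in> X" for a b c
    using that assoc[of a b a c] by (auto simp: between_def closed M1 M1' perm)
  show "between a (\<mu> a b c) b" "between a (\<mu> a b c) c" "between b (\<mu> a b c) c"
    using *[OF assms] *[of a c b] *[of b c a] assms by (simp_all add: perm)
qed

lemma between_trans:
  assumes "between a c b" "between a x c"
  shows "between a x b"
  using assms assoc[of x a c b] unfolding between_def by (metis perm)

lemma between_swap:
  assumes "between a c b" "between a x c"
  shows "between x c b"
  using assms assoc[of x c a b] unfolding between_def by (metis perm M1')

lemma between_antisym:
  assumes "between a x y" "between a y x"
  shows "x = y"
  using assms unfolding between_def by (metis perm)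

text \<open>
  Put \<open>m = \<mu> a b c\<close>. In the orders based at \<open>a\<close> and at \<open>b\<close>, the point \<open>x\<close> is below \<open>m\<close>, that is, \<open>x\<close> lies
  between \<open>a\<close> and \<open>m\<close> and between \<open>b\<close> and \<open>m\<close>. As \<open>m\<close> lies between \<open>a\<close> and \<open>b\<close>, the first
  makes \<open>m\<close> lie between \<open>b\<close> and \<open>x\<close>, and antisymmetry gives equality.
\<close>

lemma median_unique:
  assumes "between a x b" "between b x c" "between a x c"
  shows "x = \<mu> a b c"
proof -
  have X: "a \<in> X" "b \<in> X" "c \<in> X" "x \<in> X" using assms by (auto simp: between_def)
  have *: "between b x (\<mu> a b c)" if "between a x b" "between b x c" for a b c
    using that assoc[of x b a c] unfolding between_def by (metis closed perm)
  have "between b x (\<mu> a b c)" using * assms by blast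
  moreover have "between a x (\<mu> a b c)"
    using *[of b a c] assms between_sym X perm by metis
  moreover have "between a (\<mu> a b c) b" using median_between X by blast
  ultimately have "between b (\<mu> a b c) x"
    using between_swap between_sym by blast
  with \<open>between b x (\<mu> a b c)\<close> show ?thesis using between_antisym by blast
qed

text \<open>
  The point \<open>\<mu> a b e\<close> is a gate: every way from \<open>e\<close> into the interval from \<open>a\<close> to \<open>b\<close> passes through it. The
  idea is to take the median \<open>u\<close> of \<open>e\<close> with the points \<open>p = \<mu> a x e\<close> and \<open>q = \<mu> b x e\<close> on the two sides of \<open>x\<close>.
  The points \<open>a, p, x, q, b\<close> are in line, so \<open>u\<close> lies between \<open>a\<close> and \<open>b\<close>; computed in the
  semilattice based at \<open>e\<close>, \<open>u\<close> is the meet of the gate with \<open>x\<close>. Hence \<open>u\<close> has the three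
  betweenness properties that characterize the gate, and lies between \<open>x\<close> and \<open>e\<close>.
\<close>

lemma gate:
  assumes x: "between a x b" and e: "e \<in> X"
  shows "between x (\<mu> a b e) e"
proof -
  have X: "a \<in> X" "b \<in> X" "x \<in> X" using x by (auto simp: between_def)
  define g p q u where "g = \<mu> a b e" and "p = \<mu> a x e" and "q = \<mu> b x e" and "u = \<mu> p q e"
  have in_X: "g \<in> X" "p \<in> X" "q \<in> X" "u \<in> X"
    using X e closed by (auto simp: g_def p_def q_def u_def)
  have ap: "between a p x" and bq: "between b q x"
    using X e median_between by (auto simp: p_def q_def)
  have "between a x q" using between_swap[of b x a q] bq between_sym x by blast
  then have "between a p q" using between_trans ap by blast
  moreover have "between a q b" using between_trans[of b x a q] bq x between_sym by blast
  moreover have "between p u q" using in_X e median_between by (auto simp: u_def)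
  ultimately have ub: "between a u b"
    using between_trans between_sym by meson
  \<comment> \<open>The meet of \<open>a \<and> x\<close> and \<open>b \<and> x\<close> in the semilattice based at \<open>e\<close>.\<close>
  have ug: "u = \<mu> g e x"
  proof -
    have "u = \<mu> (\<mu> a e x) e (\<mu> b e x)" using X e in_X by (simp add: u_def p_def q_def perm closed)
    also have "\<dots> = \<mu> a e (\<mu> x e (\<mu> x e b))" 
      using X e by (subst assoc) (simp_all add: perm closed)
    also have "\<mu> x e (\<mu> x e b) = \<mu> x e b" 
      using X e by (subst assoc[symmetric]) (simp_all add: closed M1')
    also have "\<mu> a e (\<mu> x e b) = \<mu> a e (\<mu> b e x)" using X e by (simp add: perm closed)
    also have "\<dots> = \<mu> (\<mu> a e b) e x" using X e by (subst assoc) (simp_all)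
    also have "\<dots> = \<mu> g e x" using X e by (simp add: g_def perm)
    finally show ?thesis .
  qed
  have eu: "between e u g" using ug in_X X e median_between(1)[of g e x] between_sym by blast
  have "between e g a" "between e g b"
    using X e median_between[of a b e] between_sym unfolding g_def by blast+
  then have "between b u e" "between a u e"
    using eu between_trans between_sym by blast+
  with ub have "u = g" unfolding g_def by (rule median_unique)
  moreover have "between x u e" using ug in_X X e median_between(3)[of g e x] between_sym by blast
  ultimately show ?thesis unfolding g_def by simp
qed

text \<open>
  The gate of \<open>z\<close> lies between \<open>x\<close> and \<open>z\<close> and between \<open>y\<close> and \<open>z\<close>. As \<open>z\<close> lies between \<open>x\<close> and \<open>y\<close>,
  this is possible only if \<open>z\<close> is its own gate.
\<close>

lemma interval_convex:
  assumes "between a x b" "between a y b" "between x z y"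
  shows "between a z b"
proof -
  have X: "a \<in> X" "b \<in> X" "z \<in> X" using assms by (auto simp: between_def)
  have "between x (\<mu> a b z) z" "between y (\<mu> a b z) z"
    using assms X gate by auto
  then have "\<mu> a b z = z"
    using assms(3) between_swap between_antisym between_sym by meson
  then show ?thesis using X median_between by metis
qed

text \<open>
  Principal upper sets of the order based at \<open>r\<close> are convex. Let \<open>t = \<mu> r s z\<close>. In the order based at
  \<open>t\<close>, the point \<open>s\<close> is below \<open>x\<close> and \<open>y\<close>, hence below their meet \<open>\<mu> x y t\<close>. The latter is the gate of
  \<open>t\<close> in the interval from \<open>x\<close> to \<open>y\<close>, which contains \<open>z\<close>; hence \<open>s\<close> is below \<open>z\<close> as well, and then \<open>s = t\<close>.
\<close>

lemma upset_convex:
  assumes "between r s x" "between r s y" "between x z y"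
  shows "between r s z"
proof -
  have X: "r \<in> X" "s \<in> X" "x \<in> X" "y \<in> X" "z \<in> X" using assms by (auto simp: between_def)
  define t where "t = \<mu> r s z"
  have t: "between r t s" "between s t z" "t \<in> X" "between r t z"
    using X median_between closed by (auto simp: t_def)
  have sx: "between t s x" "between t s y"
    using between_swap assms t by blast+
  have "between z (\<mu> x y t) t" using gate assms t by blast
  moreover have "between t s (\<mu> x y t)"
    using sx assoc[of s t x y] X t unfolding between_def by (metis perm closed)
  ultimately have "between t s z"
    using between_trans between_sym by blast
  with t(2) have "s = t" using between_antisym between_sym by blast
  with t show ?thesis by simp
qed

text \<open>
  Let \<open>p, q, r\<close> be the projections of \<open>x, y, z\<close> and \<open>s = \<mu> p q r\<close>; the aim is \<open>s = r\<close>. In the order based at \<open>r\<close>,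
  \<open>s\<close> is below \<open>p\<close> and \<open>q\<close>, which are below \<open>x\<close> and \<open>y\<close> by the gate property, so \<open>s\<close> is below \<open>z\<close> by
  convexity of upper sets. On the other hand \<open>s\<close> lies between \<open>a\<close> and \<open>b\<close>, so the gate \<open>r\<close> of \<open>z\<close> lies
  between \<open>s\<close> and \<open>z\<close>.
\<close>

lemma projection_between:
  assumes "between x z y" "a \<in> X" "b \<in> X"
  shows "between (\<mu> a b x) (\<mu> a b z) (\<mu> a b y)"
proof -
  have X: "x \<in> X" "y \<in> X" "z \<in> X" using assms by (auto simp: between_def)
  define p q r s where "p = \<mu> a b x" and "q = \<mu> a b y" and "r = \<mu> a b z" and "s = \<mu> p q r"
  have ab: "between a p b" "between a q b" "between a r b"
    using X assms median_between by (auto simp: p_def q_def r_def)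
  have in_X: "p \<in> X" "q \<in> X" "r \<in> X" using ab by (auto simp: between_def)
  have s: "between p s q" "between r s p" "between r s q"
    using in_X median_between[of p q r] between_sym by (auto simp: s_def)
  have "between r p x" "between r q y" using gate ab X by (auto simp: p_def q_def)
  then have "between r s x" "between r s y" using between_trans s by blast+
  then have "between r s z" using upset_convex assms by blast
  moreover have "between s r z"
    using gate[OF interval_convex[OF ab(1,2) s(1)] X(3)] by (simp add: r_def)
  ultimately have "s = r" using between_antisym between_sym by blast
  with s show ?thesis by (simp add: p_def q_def r_def)
qed

text \<open>
  The left-hand side \<open>r\<close> has the three betweenness properties that characterize the median on the right:
  projection to the interval from \<open>a\<close> to \<open>b\<close> preserves betweenness, and where the projection of \<open>e\<close> appears
  instead of \<open>e\<close>, the gate property replaces one by the other.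
\<close>

theorem distributive:
  assumes "a \<in> X" "b \<in> X" "c \<in> X" "d \<in> X" "e \<in> X"
  shows "\<mu> a b (\<mu> c d e) = \<mu> (\<mu> a b c) (\<mu> a b d) e"
proof -
  define r where "r = \<mu> a b (\<mu> c d e)"
  have *: "between (\<mu> a b x) r e" if "x \<in> X" "between x (\<mu> c d e) e" for x
  proof -
    have "between (\<mu> a b x) r (\<mu> a b e)"
      using projection_between that assms by (auto simp: r_def)
    moreover have "between (\<mu> a b x) (\<mu> a b e) e"
      using gate median_between assms that by blast
    ultimately show ?thesis using between_trans by blast
  qed
  have "between (\<mu> a b c) r (\<mu> a b d)"
    using projection_between median_between assms by (auto simp: r_def)
  moreover have "between (\<mu> a b c) r e" "between (\<mu> a b d) r e"
    using * median_between assms by auto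
  ultimately show ?thesis using median_unique by (simp add: r_def)
qed

end


section \<open>Coarse median spaces as exact median algebras of functions\<close>

context coarse_median_space
begin

lemma median_bornologous:
  assumes "C \<ge> 0"
  obtains B where "B \<ge> 0"
    "\<And>a a' b b' c c'. \<lbrakk>a \<in> X; a' \<in> X; b \<in> X; b' \<in> X; c \<in> X; c' \<in> X;
       d a a' \<le> C; d b b' \<le> C; d c c' \<le> C\<rbrakk> \<Longrightarrow> d (\<mu> a b c) (\<mu> a' b' c') \<le> B"
proof -
  obtain p q where pq: "\<And>a a' b c. \<lbrakk>a \<in> X; a' \<in> X; b \<in> X; c \<in> X\<rbrakk> \<Longrightarrow>
      d (\<mu> a b c) (\<mu> a' b c) \<le> p * d a a' + q"
    using C1 nonneg by metis
  define L where "L = \<bar>p\<bar> * C + \<bar>q\<bar>"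
  have L: "d (\<mu> a b c) (\<mu> a' b c) \<le> L"
    if "a \<in> X" "a' \<in> X" "b \<in> X" "c \<in> X" "d a a' \<le> C" for a a' b c
  proof -
    have "p * d a a' \<le> \<bar>p\<bar> * d a a'" by (simp add: mult_right_mono)
    also have "\<dots> \<le> \<bar>p\<bar> * C" using that by (simp add: mult_left_mono)
    finally show ?thesis using pq[of a a' b c] that by (simp add: L_def)
  qed
  show thesis
  proof (rule that[of "3 * L"])
    show "3 * L \<ge> 0" using assms by (simp add: L_def)
    fix a a' b b' c c'
    assume *: "a \<in> X" "a' \<in> X" "b \<in> X" "b' \<in> X" "c \<in> X" "c' \<in> X"
       "d a a' \<le> C" "d b b' \<le> C" "d c c' \<le> C"
    have "d (\<mu> a b c) (\<mu> a' b c) \<le> L" using L * by blast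
    moreover have "d (\<mu> a' b c) (\<mu> a' b' c) \<le> L"
      using L[of b b' a' c] * perm[of a' b c] perm[of a' b' c] by simp
    moreover have "d (\<mu> a' b' c) (\<mu> a' b' c') \<le> L"
      using L[of c c' b' a'] * perm(1)[of a' b' c] perm(1)[of a' b' c'] 
        perm(2)[of b' a' c] perm(2)[of b' a' c'] perm(1)[of b' c a'] perm(1)[of b' c' a'] by simp
    moreover have "d (\<mu> a b c) (\<mu> a' b' c') \<le>
        d (\<mu> a b c) (\<mu> a' b c) + d (\<mu> a' b c) (\<mu> a' b' c) + d (\<mu> a' b' c) (\<mu> a' b' c')"
      using triangle[of "\<mu> a b c" "\<mu> a' b c" "\<mu> a' b' c'"]
        triangle[of "\<mu> a' b c" "\<mu> a' b' c" "\<mu> a' b' c'"] * closed by fastforce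
    ultimately show "d (\<mu> a b c) (\<mu> a' b' c') \<le> 3 * L" by linarith
  qed
qed

text \<open>
  The family \<open>I \<rightarrow> X\<close> modulo uniformly bounded distance. The quotient is realized by a choice of one
  representative in each class, so that its elements are again functions and its median is the
  pointwise one followed by \<open>rep\<close>.
\<close>

definition close :: "'i set \<Rightarrow> ('i \<Rightarrow> 'a) \<Rightarrow> ('i \<Rightarrow> 'a) \<Rightarrow> bool" where
  "close I f g \<longleftrightarrow> f \<in> I \<rightarrow> X \<and> g \<in> I \<rightarrow> X \<and> (\<exists>C\<ge>0. \<forall>i\<in>I. d (f i) (g i) \<le> C)"

definition rep :: "'i set \<Rightarrow> ('i \<Rightarrow> 'a) \<Rightarrow> 'i \<Rightarrow> 'a" where
  "rep I f = (SOME g. close I f g)"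

lemma close_refl: "f \<in> I \<rightarrow> X \<Longrightarrow> close I f f"
  unfolding close_def by (auto intro!: exI[of _ 0] simp: Pi_iff)

lemma close_sym: "close I f g \<Longrightarrow> close I g f"
  unfolding close_def by (auto simp: commute)

lemma close_trans:
  assumes "close I f g" "close I g h"
  shows "close I f h"
proof -
  obtain C D where "C \<ge> 0" "D \<ge> 0" "\<forall>i\<in>I. d (f i) (g i) \<le> C" "\<forall>i\<in>I. d (g i) (h i) \<le> D"
    using assms unfolding close_def by blast
  moreover have "d (f i) (h i) \<le> d (f i) (g i) + d (g i) (h i)" if "i \<in> I" for i
    using assms that by (intro triangle) (auto simp: close_def)
  ultimately have "\<forall>i\<in>I. d (f i) (h i) \<le> C + D" "C + D \<ge> 0" by fastforce+
  then show ?thesis using assms unfolding close_def by blast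
qed

lemma close_rep: "f \<in> I \<rightarrow> X \<Longrightarrow> close I f (rep I f)"
  unfolding rep_def using close_refl by (metis someI)

lemma rep_eq: "close I f g \<Longrightarrow> rep I f = rep I g"
  unfolding rep_def by (intro arg_cong[of _ _ Eps] ext iffI) (blast intro: close_sym close_trans)+

lemma rep_eq_D: "\<lbrakk>f \<in> I \<rightarrow> X; g \<in> I \<rightarrow> X; rep I f = rep I g\<rbrakk> \<Longrightarrow> close I f g"
  by (metis close_rep close_sym close_trans)

lemma close_median:
  assumes "close I f f'" "close I g g'" "close I h h'"
  shows "close I (\<lambda>i. \<mu> (f i) (g i) (h i)) (\<lambda>i. \<mu> (f' i) (g' i) (h' i))"
proof -
  obtain C1 C2 C3 where C: "C1 \<ge> 0" "\<forall>i\<in>I. d (f i) (f' i) \<le> C1" 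
      "\<forall>i\<in>I. d (g i) (g' i) \<le> C2" "\<forall>i\<in>I. d (h i) (h' i) \<le> C3"
    using assms unfolding close_def by blast
  obtain B where "B \<ge> 0"
    "\<And>a a' b b' c c'. \<lbrakk>a \<in> X; a' \<in> X; b \<in> X; b' \<in> X; c \<in> X; c' \<in> X;
       d a a' \<le> max C1 (max C2 C3); d b b' \<le> max C1 (max C2 C3); d c c' \<le> max C1 (max C2 C3)\<rbrakk>
      \<Longrightarrow> d (\<mu> a b c) (\<mu> a' b' c') \<le> B"
    using median_bornologous[of "max C1 (max C2 C3)"] C(1) by (simp add: le_max_iff_disj) blast
  then have "\<forall>i\<in>I. d (\<mu> (f i) (g i) (h i)) (\<mu> (f' i) (g' i) (h' i)) \<le> B"
    using assms C unfolding close_def by (auto simp: Pi_iff le_max_iff_disj)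
  then show ?thesis
    using assms \<open>B \<ge> 0\<close> unfolding close_def by (auto simp: Pi_iff closed)
qed

text \<open>
  The constant in (C2) is uniform in the four points, so the two sides of the associative law are
  functions at bounded distance and become equal in the quotient. (M1) and (M2) hold pointwise.
\<close>

lemma quotient_median_algebra:
  "exact_median_algebra (rep I ` (I \<rightarrow> X)) (\<lambda>f g h. rep I (\<lambda>i. \<mu> (f i) (g i) (h i)))"
  (is "exact_median_algebra ?Y ?m")
proof
  have Y: "f \<in> I \<rightarrow> X \<and> rep I f = f" if "f \<in> ?Y" for f
  proof -
    from that obtain f' where f': "f' \<in> I \<rightarrow> X" "f = rep I f'" by blast
    then have c: "close I f' f" using close_rep by blast
    then have "f \<in> I \<rightarrow> X" by (simp add: close_def)
    moreover have "rep I f = f" using trans[OF f'(2) rep_eq[OF c]] by (rule sym)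
    ultimately show ?thesis ..
  qed
  have med: "(\<lambda>i. \<mu> (f i) (g i) (h i)) \<in> I \<rightarrow> X" if "f \<in> I \<rightarrow> X" "g \<in> I \<rightarrow> X" "h \<in> I \<rightarrow> X" for f g h
    using that closed by (auto simp: Pi_iff)
  have cong: "rep I f = rep I g" if "f \<in> I \<rightarrow> X" "\<And>i. i \<in> I \<Longrightarrow> f i = g i" for f g
    using that by (intro rep_eq) (auto simp: close_def Pi_iff intro!: exI[of _ 0])
  show "?m f g h \<in> ?Y" if "f \<in> ?Y" "g \<in> ?Y" "h \<in> ?Y" for f g h
    using med[of f g h] Y that by blast
  show "?m f f g = f" if "f \<in> ?Y" "g \<in> ?Y" for f g
  proof -
    have F: "f \<in> I \<rightarrow> X" "g \<in> I \<rightarrow> X" using that Y by blast+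
    then have "\<mu> (f i) (f i) (g i) = f i" if "i \<in> I" for i using that M1 by blast
    then have "?m f f g = rep I f" by (rule cong[OF med[OF F(1) F]])
    then show ?thesis using Y[OF that(1)] by (metis (no_types))
  qed
  show "?m f g h = ?m f h g \<and> ?m f g h = ?m g f h" if "f \<in> ?Y" "g \<in> ?Y" "h \<in> ?Y" for f g h
  proof
    have F: "f \<in> I \<rightarrow> X" "g \<in> I \<rightarrow> X" "h \<in> I \<rightarrow> X" using that Y by blast+
    then have *: "f i \<in> X" "g i \<in> X" "h i \<in> X" if "i \<in> I" for i using that by auto
    show "?m f g h = ?m f h g" by (rule cong[OF med[OF F]]) (intro perm(2) *)
    show "?m f g h = ?m g f h" by (rule cong[OF med[OF F]]) (intro perm(1) *)
  qed
  show "?m (?m f g h) g k = ?m f g (?m h g k)"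
    if "f \<in> ?Y" "g \<in> ?Y" "h \<in> ?Y" "k \<in> ?Y" for f g h k
  proof (rule rep_eq)
    have F: "f \<in> I \<rightarrow> X" "g \<in> I \<rightarrow> X" "h \<in> I \<rightarrow> X" "k \<in> I \<rightarrow> X" using that Y by blast+
    then have *: "f i \<in> X" "g i \<in> X" "h i \<in> X" "k i \<in> X" if "i \<in> I" for i using that by auto
    have "close I (\<lambda>i. \<mu> (?m f g h i) (g i) (k i)) (\<lambda>i. \<mu> (\<mu> (f i) (g i) (h i)) (g i) (k i))"
      by (intro close_median close_refl F close_sym[OF close_rep] med)
    moreover have "close I (\<lambda>i. \<mu> (f i) (g i) (\<mu> (h i) (g i) (k i))) (\<lambda>i. \<mu> (f i) (g i) (?m h g k i))"
      by (intro close_median close_refl F close_rep med)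
    moreover have "close I (\<lambda>i. \<mu> (\<mu> (f i) (g i) (h i)) (g i) (k i))
        (\<lambda>i. \<mu> (f i) (g i) (\<mu> (h i) (g i) (k i)))"
    proof -
      obtain \<kappa> where "\<kappa> > 0" "\<forall>a\<in>X. \<forall>b\<in>X. \<forall>c\<in>X. \<forall>e\<in>X.
          d (\<mu> (\<mu> a b c) b e) (\<mu> a b (\<mu> c b e)) \<le> \<kappa>"
        using C2 by blast
      then show ?thesis using * unfolding close_def
        by (auto intro!: closed exI[of _ \<kappa>])
    qed
    ultimately show "close I (\<lambda>i. \<mu> (?m f g h i) (g i) (k i)) (\<lambda>i. \<mu> (f i) (g i) (?m h g k i))"
      using close_trans by blast
  qed
qed

text \<open>
  The coordinate functions on \<open>X \<times> X \<times> X \<times> X \<times> X\<close> are generic quintuples: equality in the quotient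
  of two terms in them is a bound for the distance of these terms that is uniform over all quintuples of points.
\<close>

lemma coarsely_distributive:
  obtains C where "C \<ge> 0" "\<And>a b c e k. \<lbrakk>a \<in> X; b \<in> X; c \<in> X; e \<in> X; k \<in> X\<rbrakk> \<Longrightarrow>
    d (\<mu> a b (\<mu> c e k)) (\<mu> (\<mu> a b c) (\<mu> a b e) k) \<le> C"
proof -
  define I where "I = X \<times> X \<times> X \<times> X \<times> X"
  define A B P Q R :: "'a \<times> 'a \<times> 'a \<times> 'a \<times> 'a \<Rightarrow> 'a"
    where "A = (\<lambda>(a,b,c,e,k). a)" and "B = (\<lambda>(a,b,c,e,k). b)" and "P = (\<lambda>(a,b,c,e,k). c)"
      and "Q = (\<lambda>(a,b,c,e,k). e)" and "R = (\<lambda>(a,b,c,e,k). k)"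
  note defs = A_def B_def P_def Q_def R_def
  have F: "A \<in> I \<rightarrow> X" "B \<in> I \<rightarrow> X" "P \<in> I \<rightarrow> X" "Q \<in> I \<rightarrow> X" "R \<in> I \<rightarrow> X"
    by (auto simp: I_def defs)
  define m where "m = (\<lambda>f g h. rep I (\<lambda>i. \<mu> (f i) (g i) (h i)))"
  interpret Q: exact_median_algebra "rep I ` (I \<rightarrow> X)" m
    unfolding m_def by (rule quotient_median_algebra)
  have med: "(\<lambda>i. \<mu> (f i) (g i) (h i)) \<in> I \<rightarrow> X" if "f \<in> I \<rightarrow> X" "g \<in> I \<rightarrow> X" "h \<in> I \<rightarrow> X" for f g h
    using that closed by (auto simp: Pi_iff)
  have m: "m (rep I f) (rep I g) (rep I h) = rep I (\<lambda>i. \<mu> (f i) (g i) (h i))"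
    if "f \<in> I \<rightarrow> X" "g \<in> I \<rightarrow> X" "h \<in> I \<rightarrow> X" for f g h
    unfolding m_def by (intro rep_eq close_median close_sym[OF close_rep] that)
  have "m (rep I A) (rep I B) (m (rep I P) (rep I Q) (rep I R)) =
      m (m (rep I A) (rep I B) (rep I P)) (m (rep I A) (rep I B) (rep I Q)) (rep I R)"
    using F by (intro Q.distributive) auto
  then have "rep I (\<lambda>i. \<mu> (A i) (B i) (\<mu> (P i) (Q i) (R i))) =
      rep I (\<lambda>i. \<mu> (\<mu> (A i) (B i) (P i)) (\<mu> (A i) (B i) (Q i)) (R i))"
    using F by (simp add: m med)
  then have "close I (\<lambda>i. \<mu> (A i) (B i) (\<mu> (P i) (Q i) (R i)))
      (\<lambda>i. \<mu> (\<mu> (A i) (B i) (P i)) (\<mu> (A i) (B i) (Q i)) (R i))"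
    using F by (intro rep_eq_D med)
  then obtain C where "C \<ge> 0" "\<forall>i\<in>I. d (\<mu> (A i) (B i) (\<mu> (P i) (Q i) (R i)))
      (\<mu> (\<mu> (A i) (B i) (P i)) (\<mu> (A i) (B i) (Q i)) (R i)) \<le> C"
    unfolding close_def by blast
  then show thesis using that[of C] by (auto simp: I_def defs)
qed

text \<open>
  A point \<open>\<mu> a x b\<close> is close to \<open>\<mu> a x a = a\<close>.
\<close>

lemma interval_in_ball:
  assumes "C \<ge> 0"
  obtains r where "r > 0"
    "\<And>a b. \<lbrakk>a \<in> X; b \<in> X; d a b \<le> C\<rbrakk> \<Longrightarrow> med_interval X \<mu> a b \<subseteq> mball a r"
proof -
  obtain B where B: "B \<ge> 0"
    "\<And>a a' b b' c c'. \<lbrakk>a \<in> X; a' \<in> X; b \<in> X; b' \<in> X; c \<in> X; c' \<in> X;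
       d a a' \<le> C; d b b' \<le> C; d c c' \<le> C\<rbrakk> \<Longrightarrow> d (\<mu> a b c) (\<mu> a' b' c') \<le> B"
    using median_bornologous[OF assms] by metis
  show thesis
  proof (rule that[of "B + 1"])
    show "B + 1 > 0" using B by simp
    fix a b assume ab: "a \<in> X" "b \<in> X" "d a b \<le> C"
    show "med_interval X \<mu> a b \<subseteq> mball a (B + 1)"
    proof
      fix y assume "y \<in> med_interval X \<mu> a b"
      then obtain x where x: "x \<in> X" "y = \<mu> a x b" by (auto simp: med_interval_def)
      have "d (\<mu> a x a) (\<mu> a x b) \<le> B" using ab x assms by (intro B) auto
      then show "y \<in> mball a (B + 1)" using ab x by (simp add: M1' closed in_mball)
    qed
  qed
qed

theorem bounded_geometry_imp_algebra:
  assumes "bounded_geometry_space X d"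
  shows "coarse_median_algebra X \<mu>"
proof
  have bg: "\<exists>n::nat. \<forall>x\<in>X. finite (mball x r) \<and> card (mball x r) \<le> n" if "r > 0" for r
    using assms that bounded_geometry_space.bounded_geometry by blast
  have *: "\<exists>K\<ge>0. \<forall>a\<in>X. \<forall>b\<in>X. d a b \<le> C \<longrightarrow> card_at_most (med_interval X \<mu> a b) K" if C: "C \<ge> 0" for C
  proof -
    obtain r where r: "r > 0"
      "\<And>a b. \<lbrakk>a \<in> X; b \<in> X; d a b \<le> C\<rbrakk> \<Longrightarrow> med_interval X \<mu> a b \<subseteq> mball a r"
      using interval_in_ball[OF C] by metis
    obtain n :: nat where n: "\<forall>x\<in>X. finite (mball x r) \<and> card (mball x r) \<le> n"
      using bg r by blast
    have "card_at_most (med_interval X \<mu> a b) (real n)" if "a \<in> X" "b \<in> X" "d a b \<le> C" for a b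
      using r(2)[OF that] n that unfolding card_at_most_def
      by (meson card_mono finite_subset le_trans of_nat_le_iff)
    then show ?thesis by (intro exI[of _ "real n"]) auto
  qed
  show "finite_intervals X \<mu>"
    unfolding finite_intervals_def using * nonneg by (metis card_at_most_def order_refl)
  obtain C where "C \<ge> 0" "\<And>a b c e k. \<lbrakk>a \<in> X; b \<in> X; c \<in> X; e \<in> X; k \<in> X\<rbrakk> \<Longrightarrow>
    d (\<mu> a b (\<mu> c e k)) (\<mu> (\<mu> a b c) (\<mu> a b e) k) \<le> C"
    using coarsely_distributive by blast
  then show "\<exists>K\<ge>0. \<forall>a\<in>X. \<forall>b\<in>X. \<forall>c\<in>X. \<forall>d\<in>X. \<forall>e\<in>X.
      card_at_most (med_interval X \<mu> (\<mu> a b (\<mu> c d e)) (\<mu> (\<mu> a b c) (\<mu> a b d) e)) K"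
    using *[of C] by (meson closed)
qed

end


section \<open>The induced distance\<close>

lemma interval_chain_Suc:
  "interval_chain X \<mu> a c (Suc n) x \<longleftrightarrow>
     interval_chain X \<mu> a (x n) n x \<and> x (Suc n) = c \<and> c \<in> X \<and> finite (med_interval X \<mu> (x n) c)"
proof -
  have "{1..Suc n} = insert (Suc n) {1..n}" by auto
  then show ?thesis unfolding interval_chain_def by (auto simp: le_Suc_eq simp del: One_nat_def)
qed

text \<open>
  \<open>joined X \<mu> a b s\<close> means that some chain of finite intervals from \<open>a\<close> to \<open>b\<close> has total length \<open>s\<close>.
  Replacing indexed chains by an inductive predicate turns arguments about chains into inductions on the
  last step.
\<close>

inductive joined :: "'a set \<Rightarrow> ('a \<Rightarrow> 'a \<Rightarrow> 'a \<Rightarrow> 'a) \<Rightarrow> 'a \<Rightarrow> 'a \<Rightarrow> nat \<Rightarrow> bool"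
  for X :: "'a set" and \<mu> :: "'a \<Rightarrow> 'a \<Rightarrow> 'a \<Rightarrow> 'a" and a :: 'a where
  joined_refl: "a \<in> X \<Longrightarrow> joined X \<mu> a a 0"
| joined_step: "\<lbrakk>joined X \<mu> a b s; c \<in> X; finite (med_interval X \<mu> b c)\<rbrakk> \<Longrightarrow>
    joined X \<mu> a c (s + (card (med_interval X \<mu> b c) - 1))"

lemma joined_in: "joined X \<mu> a b s \<Longrightarrow> a \<in> X \<and> b \<in> X"
  by (induction rule: joined.induct) auto

lemma joined_iff_chain:
  "joined X \<mu> a b s \<longleftrightarrow> (\<exists>n x. interval_chain X \<mu> a b n x \<and>
     s = (\<Sum>i=1..n. (card (med_interval X \<mu> (x (i - 1)) (x i)) - 1)))"
  (is "_ \<longleftrightarrow> (\<exists>n x. _ \<and> s = ?w n x)")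
proof
  show "\<exists>n x. interval_chain X \<mu> a b n x \<and> s = ?w n x" if "joined X \<mu> a b s"
    using that
  proof induction
    case joined_refl
    then show ?case by (intro exI[of _ 0] exI[of _ "\<lambda>_. a"]) (simp add: interval_chain_def)
  next
    case (joined_step b s c)
    then obtain n x where nx: "interval_chain X \<mu> a b n x" "s = ?w n x" by blast
    define y where "y = x(Suc n := c)"
    have "x n = b" using nx(1) by (simp add: interval_chain_def)
    then have "interval_chain X \<mu> a c (Suc n) y"
      using nx(1) joined_step.hyps
      by (auto simp: interval_chain_def y_def le_Suc_eq atLeastAtMostSuc_conv)
    moreover have "?w n y = ?w n x"
      by (intro sum.cong) (auto simp: y_def)
    then have "?w (Suc n) y = s + (card (med_interval X \<mu> b c) - 1)"
      using nx(2) \<open>x n = b\<close> by (simp add: y_def)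
    ultimately show ?case by metis
  qed
  have "joined X \<mu> a b (?w n x)" if "interval_chain X \<mu> a b n x" for n x
    using that
  proof (induction n arbitrary: b)
    case 0
    then show ?case by (auto simp: interval_chain_def intro: joined_refl)
  next
    case (Suc n)
    then have "joined X \<mu> a (x n) (?w n x)" "x (Suc n) = b" "b \<in> X" "finite (med_interval X \<mu> (x n) b)"
      by (auto simp: interval_chain_Suc)
    from joined_step[OF this(1,3,4)] this(2) show ?case by simp
  qed
  then show "joined X \<mu> a b s" if "\<exists>n x. interval_chain X \<mu> a b n x \<and> s = ?w n x"
    using that by blast
qed

lemma induced_dist_eq:
  "induced_dist X \<mu> a b = (if a \<in> X \<and> b \<in> X then real (LEAST s. joined X \<mu> a b s) else 0)"
  unfolding induced_dist_def joined_iff_chain ..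

lemma induced_dist_defined_iff:
  "induced_dist_defined X \<mu> \<longleftrightarrow> (\<forall>a\<in>X. \<forall>b\<in>X. \<exists>s. joined X \<mu> a b s)"
  unfolding induced_dist_defined_def joined_iff_chain by blast

lemma joined_trans:
  assumes "joined X \<mu> b c t" "joined X \<mu> a b s"
  shows "joined X \<mu> a c (s + t)"
  using assms
proof induction
  case (joined_step c t e)
  then show ?case using joined.joined_step[of X \<mu> a c "s + t" e] by (simp add: add.assoc)
qed simp

lemma joined_single:
  assumes "a \<in> X" "b \<in> X" "finite (med_interval X \<mu> a b)"
  shows "joined X \<mu> a b (card (med_interval X \<mu> a b) - 1)"
  using joined_step[OF joined_refl] assms by fastforce

context symmetric_ternary_algebra
begin

lemma interval_sym: "\<lbrakk>a \<in> X; b \<in> X\<rbrakk> \<Longrightarrow> med_interval X \<mu> a b = med_interval X \<mu> b a"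
  unfolding med_interval_def by (metis (no_types, lifting) M2)

lemma endpoints_in_interval:
  assumes "a \<in> X" "b \<in> X"
  shows "a \<in> med_interval X \<mu> a b" "b \<in> med_interval X \<mu> a b"
  using assms M1 M1' unfolding med_interval_def by force+

lemma interval_refl: "a \<in> X \<Longrightarrow> med_interval X \<mu> a a = {a}"
  using M1' unfolding med_interval_def by force

lemma card_interval_1:
  assumes "a \<in> X" "b \<in> X" "finite (med_interval X \<mu> a b)" "card (med_interval X \<mu> a b) \<le> 1"
  shows "a = b"
  using endpoints_in_interval[OF assms(1,2)] assms(3,4) card_le_Suc0_iff_eq by auto

lemma joined_sym: "joined X \<mu> a b s \<Longrightarrow> joined X \<mu> b a s"
proof (induction rule: joined.induct)
  case joined_refl
  then show ?case by (rule joined.joined_refl)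
next
  case (joined_step b s c)
  have "joined X \<mu> c b (card (med_interval X \<mu> b c) - 1)"
    using joined_single[of c X b \<mu>] joined_step.hyps joined_in interval_sym by metis
  from joined_trans[OF joined_step.IH this] show ?case by (simp add: add.commute)
qed

lemma joined_0: "joined X \<mu> a b 0 \<Longrightarrow> a = b"
proof (induction b "0::nat" rule: joined.induct)
  case (joined_step b s c)
  then show ?case using card_interval_1[of b c] joined_in[of X \<mu> a b s] by auto
qed simp

lemma joined_induced_dist:
  assumes "induced_dist_defined X \<mu>" "a \<in> X" "b \<in> X"
  obtains s where "joined X \<mu> a b s" "induced_dist X \<mu> a b = real s"
    "\<And>t. joined X \<mu> a b t \<Longrightarrow> s \<le> t"
proof (rule that)
  have "\<exists>s. joined X \<mu> a b s" using assms unfolding induced_dist_defined_iff by blast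
  then show "joined X \<mu> a b (LEAST s. joined X \<mu> a b s)" by (rule LeastI_ex)
  show "induced_dist X \<mu> a b = real (LEAST s. joined X \<mu> a b s)"
    using assms(2,3) by (simp add: induced_dist_eq)
  show "(LEAST s. joined X \<mu> a b s) \<le> t" if "joined X \<mu> a b t" for t
    using that by (rule Least_le)
qed

lemma induced_dist_le: "joined X \<mu> a b t \<Longrightarrow> induced_dist X \<mu> a b \<le> real t"
  by (auto simp: induced_dist_eq intro: Least_le)

lemma induced_dist_metric:
  assumes "induced_dist_defined X \<mu>"
  shows "Metric_space X (induced_dist X \<mu>)"
proof
  show "0 \<le> induced_dist X \<mu> a b" for a b by (simp add: induced_dist_eq)
  have "joined X \<mu> a b = joined X \<mu> b a" for a b using joined_sym by blast
  then show "induced_dist X \<mu> a b = induced_dist X \<mu> b a" for a b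
    unfolding induced_dist_eq by metis
  show "induced_dist X \<mu> a b = 0 \<longleftrightarrow> a = b" if "a \<in> X" "b \<in> X" for a b
  proof
    assume "induced_dist X \<mu> a b = 0"
    then show "a = b" using joined_induced_dist[OF assms that] joined_0 by (metis of_nat_eq_0_iff)
  next
    assume "a = b"
    then show "induced_dist X \<mu> a b = 0"
      using Least_eq_0[of "joined X \<mu> a a", OF joined_refl[OF that(1)]] by (simp add: induced_dist_eq)
  qed
  show "induced_dist X \<mu> a c \<le> induced_dist X \<mu> a b + induced_dist X \<mu> b c"
    if X: "a \<in> X" "b \<in> X" "c \<in> X" for a b c
  proof -
    obtain s where s: "joined X \<mu> a b s" "induced_dist X \<mu> a b = real s"
      using joined_induced_dist[OF assms X(1,2)] by metis
    obtain t where t: "joined X \<mu> b c t" "induced_dist X \<mu> b c = real t"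
      using joined_induced_dist[OF assms X(2,3)] by metis
    show ?thesis using induced_dist_le[OF joined_trans[OF t(1) s(1)]] s t by simp
  qed
qed

lemma valency_nat:
  assumes "bounded_valency X \<mu>" "R \<ge> 0"
  obtains P :: nat where "\<And>x. x \<in> X \<Longrightarrow>
    finite {y \<in> X. card_at_most (med_interval X \<mu> x y) R} \<and>
    card {y \<in> X. card_at_most (med_interval X \<mu> x y) R} \<le> P"
proof -
  obtain r where r: "\<And>x. x \<in> X \<Longrightarrow> card_at_most {y \<in> X. card_at_most (med_interval X \<mu> x y) R} r"
    using assms unfolding bounded_valency_def by metis
  show thesis
  proof (rule that[of "nat \<lceil>r\<rceil>"])
    fix x assume "x \<in> X"
    from r[OF this] show "finite {y \<in> X. card_at_most (med_interval X \<mu> x y) R} \<and>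
      card {y \<in> X. card_at_most (med_interval X \<mu> x y) R} \<le> nat \<lceil>r\<rceil>"
      unfolding card_at_most_def by linarith
  qed
qed

text \<open>
  Steps of length zero can be dropped, as their endpoints agree. A last step of positive length at most
  \<open>s + 1\<close> is an interval of at most \<open>s + 2\<close> elements and starts within \<open>s\<close> of \<open>a\<close>.
\<close>

lemma joined_last_step:
  assumes "joined X \<mu> a b t" "t \<le> Suc s"
  shows "\<exists>z u. u \<le> s \<and> joined X \<mu> a z u \<and> card_at_most (med_interval X \<mu> z b) (real (s + 2))"
  using assms
proof induction
  case joined_refl
  then show ?case
    by (intro exI[of _ a] exI[of _ 0]) (auto simp: card_at_most_def interval_refl joined.joined_refl)
next
  case (joined_step b t c)
  have X: "b \<in> X" using joined_in joined_step.hyps by metis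
  show ?case
  proof (cases "card (med_interval X \<mu> b c) \<le> 1")
    case True
    then have "b = c" using card_interval_1 joined_step.hyps X by blast
    then show ?thesis using joined_step by simp
  next
    case False
    then show ?thesis using joined_step by (intro exI[of _ b] exI[of _ t]) (auto simp: card_at_most_def)
  qed
qed

text \<open>
  By induction on the radius: the last step of a chain of length at most \<open>s + 1\<close> starts in the ball of
  radius \<open>s\<close> and ends in the valency set of its starting point, whose cardinality is bounded.
\<close>

lemma induced_balls_bounded:
  assumes "bounded_valency X \<mu>"
  shows "\<exists>n. \<forall>x\<in>X. finite {y. \<exists>t\<le>s. joined X \<mu> x y t} \<and> card {y. \<exists>t\<le>s. joined X \<mu> x y t} \<le> n"
proof (induction s)
  case 0
  have "{y. \<exists>t\<le>0. joined X \<mu> x y t} = {x}" if "x \<in> X" for x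
    using joined_0 joined_refl that by auto
  then show ?case by (intro exI[of _ 1]) simp
next
  case (Suc s)
  let ?B = "\<lambda>s x. {y. \<exists>t\<le>s. joined X \<mu> x y t}"
  let ?V = "\<lambda>z. {y \<in> X. card_at_most (med_interval X \<mu> z y) (real (s + 2))}"
  obtain n where n: "\<And>x. x \<in> X \<Longrightarrow> finite (?B s x) \<and> card (?B s x) \<le> n" using Suc by blast
  obtain P where P: "\<And>x. x \<in> X \<Longrightarrow> finite (?V x) \<and> card (?V x) \<le> P"
    using valency_nat[OF assms, of "real (s + 2)"] by auto
  have "finite (?B (Suc s) x) \<and> card (?B (Suc s) x) \<le> n * P" if "x \<in> X" for x
  proof -
    have sub: "?B (Suc s) x \<subseteq> (\<Union>z\<in>?B s x. ?V z)"
      using joined_last_step joined_in[of X \<mu> x] by fastforce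
    have V: "finite (?V z) \<and> card (?V z) \<le> P" if "z \<in> ?B s x" for z
      using P that joined_in[of X \<mu> x z] by blast
    then have fin: "finite (\<Union>z\<in>?B s x. ?V z)" using n[OF that] by blast
    have "card (\<Union>z\<in>?B s x. ?V z) \<le> (\<Sum>z\<in>?B s x. card (?V z))"
      using n[OF that] by (intro card_UN_le) blast
    also have "\<dots> \<le> card (?B s x) * P" using sum_bounded_above[of "?B s x" "\<lambda>z. card (?V z)" P] V by simp
    also have "\<dots> \<le> n * P" using n[OF that] by simp
    finally show ?thesis using sub fin card_mono[OF fin sub] finite_subset by (meson le_trans)
  qed
  then show ?case by blast
qed

theorem induced_bounded_geometry:
  assumes "bounded_valency X \<mu>" "induced_dist_defined X \<mu>"
  shows "bounded_geometry_space X (induced_dist X \<mu>)"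
proof -
  interpret Metric_space X "induced_dist X \<mu>" by (rule induced_dist_metric[OF assms(2)])
  show ?thesis
  proof
    show "\<forall>r>0. \<exists>n::nat. \<forall>x\<in>X. finite (mball x r) \<and> card (mball x r) \<le> n"
    proof (intro allI impI)
      fix r :: real assume "r > 0"
      let ?B = "\<lambda>x. {y. \<exists>t\<le>nat \<lceil>r\<rceil>. joined X \<mu> x y t}"
      obtain n where n: "\<forall>x\<in>X. finite (?B x) \<and> card (?B x) \<le> n"
        using induced_balls_bounded[OF assms(1)] by blast
      have "mball x r \<subseteq> ?B x" if "x \<in> X" for x
      proof
        fix y assume "y \<in> mball x r"
        then have "y \<in> X" "induced_dist X \<mu> x y < r" by auto
        with joined_induced_dist[OF assms(2) that \<open>y \<in> X\<close>] obtain s where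
          "joined X \<mu> x y s" "real s < r" by metis
        then show "y \<in> ?B x" by (auto intro!: exI[of _ s]) linarith
      qed
      then show "\<exists>n. \<forall>x\<in>X. finite (mball x r) \<and> card (mball x r) \<le> n"
        using n by (meson card_mono finite_subset le_trans)
    qed
  qed
qed

end

section \<open>The induced distance of a coarse median algebra\<close>

context coarse_median_algebra
begin

text \<open>
  A point of the translated interval has the form \<open>\<mu> (\<mu> b c a) (\<mu> b c a') z\<close>. By (M3)' it is
  \<open>K\<close>-close to the translate \<open>\<mu> b c (\<mu> a a' z)\<close> of a point of the original interval. Hence the translated
  interval is covered by one valency set for each point of the original one.
\<close>

lemma card_translated_interval:
  assumes "bounded_valency X \<mu>"
  obtains P :: nat where "\<And>a a' b c. \<lbrakk>a \<in> X; a' \<in> X; b \<in> X; c \<in> X\<rbrakk> \<Longrightarrow>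
    card (med_interval X \<mu> (\<mu> a b c) (\<mu> a' b c)) \<le> P * card (med_interval X \<mu> a a')"
proof -
  obtain K where K: "K \<ge> 0" "\<And>a b c d e. \<lbrakk>a \<in> X; b \<in> X; c \<in> X; d \<in> X; e \<in> X\<rbrakk> \<Longrightarrow>
      card_at_most (med_interval X \<mu> (\<mu> a b (\<mu> c d e)) (\<mu> (\<mu> a b c) (\<mu> a b d) e)) K"
    using M3' by blast
  let ?V = "\<lambda>x. {y \<in> X. card_at_most (med_interval X \<mu> x y) K}"
  obtain P where P: "\<And>x. x \<in> X \<Longrightarrow> finite (?V x) \<and> card (?V x) \<le> P"
    using valency_nat[OF assms K(1)] by metis
  show thesis
  proof (rule that[of P])
    fix a a' b c assume X: "a \<in> X" "a' \<in> X" "b \<in> X" "c \<in> X"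
    let ?I = "med_interval X \<mu> a a'" and ?J = "med_interval X \<mu> (\<mu> a b c) (\<mu> a' b c)"
    have finI: "finite ?I" using finite_intervals X by (simp add: finite_intervals_def)
    have IX: "w \<in> X" if "w \<in> ?I" for w using that X closed by (auto simp: med_interval_def)
    have sub: "?J \<subseteq> (\<Union>w\<in>?I. ?V (\<mu> b c w))"
    proof
      fix y assume "y \<in> ?J"
      then obtain z where z: "z \<in> X" "y = \<mu> (\<mu> a b c) z (\<mu> a' b c)" by (auto simp: med_interval_def)
      have bc: "\<mu> b c a = \<mu> a b c" "\<mu> b c a' = \<mu> a' b c" using X M2 by metis+
      have "y = \<mu> (\<mu> b c a) (\<mu> b c a') z" using z X perm closed by (simp add: bc)
      moreover have "\<mu> a a' z \<in> ?I" using z X perm(2)[of a a' z] by (auto simp: med_interval_def)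
      moreover have "y \<in> X" using z X closed by simp
      ultimately show "y \<in> (\<Union>w\<in>?I. ?V (\<mu> b c w))"
        using K(2)[of b c a a' z] X z by blast
    qed
    have V: "finite (?V (\<mu> b c w)) \<and> card (?V (\<mu> b c w)) \<le> P" if "w \<in> ?I" for w
      using P closed X IX that by blast
    have "card ?J \<le> card (\<Union>w\<in>?I. ?V (\<mu> b c w))"
      using sub finI V by (intro card_mono) blast+
    also have "\<dots> \<le> (\<Sum>w\<in>?I. card (?V (\<mu> b c w)))" using finI by (rule card_UN_le)
    also have "\<dots> \<le> card ?I * P" using sum_bounded_above[of ?I "\<lambda>w. card (?V (\<mu> b c w))" P] V by simp
    finally show "card ?J \<le> P * card ?I" by (simp add: mult.commute)
  qed
qed

text \<open>
  Cardinality of intervals controls their length \<open>card - 1\<close> only up to the summand \<open>1\<close>, which would add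
  up along a chain. It is absorbed by the factor \<open>2\<close>: an interval \<open>A\<close> with at least two points satisfies
  \<open>card A \<le> 2 * (card A - 1)\<close>, and a step along a one-point interval is translated to a trivial step.
\<close>

lemma joined_translate:
  assumes "bounded_valency X \<mu>"
  obtains L :: nat where "\<And>a a' b c s. \<lbrakk>joined X \<mu> a a' s; b \<in> X; c \<in> X\<rbrakk> \<Longrightarrow>
    \<exists>t \<le> L * s. joined X \<mu> (\<mu> a b c) (\<mu> a' b c) t"
proof -
  obtain P :: nat where P: "\<And>a a' b c. \<lbrakk>a \<in> X; a' \<in> X; b \<in> X; c \<in> X\<rbrakk> \<Longrightarrow>
    card (med_interval X \<mu> (\<mu> a b c) (\<mu> a' b c)) \<le> P * card (med_interval X \<mu> a a')"
    using card_translated_interval[OF assms] by metis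
  show thesis
  proof (rule that[of "2 * P"])
    fix a a' b c s assume "joined X \<mu> a a' s" and bc: "b \<in> X" "c \<in> X"
    then show "\<exists>t \<le> 2 * P * s. joined X \<mu> (\<mu> a b c) (\<mu> a' b c) t"
    proof induction
      case joined_refl
      then have "joined X \<mu> (\<mu> a b c) (\<mu> a b c) 0" using closed by (intro joined.joined_refl) auto
      then show ?case by auto
    next
      case (joined_step x s y)
      let ?I = "med_interval X \<mu> x y" and ?J = "med_interval X \<mu> (\<mu> x b c) (\<mu> y b c)"
      obtain t where t: "t \<le> 2 * P * s" "joined X \<mu> (\<mu> a b c) (\<mu> x b c) t" using joined_step bc by blast
      have X: "x \<in> X" "y \<in> X" using joined_step.hyps joined_in by metis+
      show ?case
      proof (cases "card ?I \<le> 1")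
        case True
        then have "x = y" using card_interval_1 X joined_step.hyps by blast
        then show ?thesis using t trans_le_add1 by (metis add_mult_distrib2)
      next
        case False
        have "finite ?J" using finite_intervals X bc closed by (simp add: finite_intervals_def)
        then have "joined X \<mu> (\<mu> a b c) (\<mu> y b c) (t + (card ?J - 1))"
          using joined.joined_step[OF t(2)] X bc closed by blast
        moreover have "t + (card ?J - 1) \<le> 2 * P * (s + (card ?I - 1))"
        proof -
          have "card ?J \<le> P * card ?I" using P X bc by blast
          also have "\<dots> \<le> P * (2 * (card ?I - 1))" using False by (intro mult_le_mono2) linarith
          finally show ?thesis using t(1) by (simp add: add_mult_distrib2)
        qed
        ultimately show ?thesis by blast
      qed
    qed
  qed
qed

lemma induced_defined: "induced_dist_defined X \<mu>"
  unfolding induced_dist_defined_iff using joined_single finite_intervals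
  by (metis finite_intervals_def)

theorem induced_coarse_median_space:
  assumes "bounded_valency X \<mu>"
  shows "coarse_median_space X (induced_dist X \<mu>) \<mu>"
proof -
  interpret Metric_space X "induced_dist X \<mu>" by (rule induced_dist_metric[OF induced_defined])
  show ?thesis
  proof
    obtain L :: nat where L: "\<And>a a' b c s. \<lbrakk>joined X \<mu> a a' s; b \<in> X; c \<in> X\<rbrakk> \<Longrightarrow>
        \<exists>t \<le> L * s. joined X \<mu> (\<mu> a b c) (\<mu> a' b c) t"
      using joined_translate[OF assms] by metis
    have "induced_dist X \<mu> (\<mu> a b c) (\<mu> a' b c) \<le> real L * induced_dist X \<mu> a a'"
      if X: "a \<in> X" "a' \<in> X" "b \<in> X" "c \<in> X" for a a' b c
    proof -
      obtain s where s: "joined X \<mu> a a' s" "induced_dist X \<mu> a a' = real s"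
        using joined_induced_dist[OF induced_defined X(1,2)] by metis
      with L X obtain t where t: "t \<le> L * s" "joined X \<mu> (\<mu> a b c) (\<mu> a' b c) t" by blast
      have "real t \<le> real L * real s" using t(1) by (metis of_nat_le_iff of_nat_mult)
      then show ?thesis using induced_dist_le[OF t(2)] s(2) by simp
    qed
    then show "\<exists>\<rho> :: real \<Rightarrow> real. (\<exists>p q. \<forall>t\<ge>0. \<rho> t = p * t + q) \<and> (\<forall>t\<ge>0. \<rho> t \<ge> 0) \<and>
      (\<forall>a\<in>X. \<forall>a'\<in>X. \<forall>b\<in>X. \<forall>c\<in>X. induced_dist X \<mu> (\<mu> a b c) (\<mu> a' b c) \<le> \<rho> (induced_dist X \<mu> a a'))"
      by (intro exI[of _ "\<lambda>t. real L * t"] conjI exI[of _ "real L"] exI[of _ 0]) auto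
    obtain K where K: "K \<ge> 0" "\<And>a b c d e. \<lbrakk>a \<in> X; b \<in> X; c \<in> X; d \<in> X; e \<in> X\<rbrakk> \<Longrightarrow>
        card_at_most (med_interval X \<mu> (\<mu> a b (\<mu> c d e)) (\<mu> (\<mu> a b c) (\<mu> a b d) e)) K"
      using M3' by blast
    \<comment> \<open>(C2) is (M3)' for \<open>a, b, c, b, e\<close>, since \<open>\<mu> a b b = b\<close>. The bound \<open>K + 1\<close> is positive even if
      \<open>K = 0\<close>.\<close>
    have "induced_dist X \<mu> (\<mu> (\<mu> a b c) b e) (\<mu> a b (\<mu> c b e)) \<le> K + 1"
      if X: "a \<in> X" "b \<in> X" "c \<in> X" "e \<in> X" for a b c e
    proof -
      let ?u = "\<mu> a b (\<mu> c b e)" and ?v = "\<mu> (\<mu> a b c) b e"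
      have at_most: "card_at_most (med_interval X \<mu> ?u ?v) K"
        using K(2)[of a b c b e] X M1' by simp
      then have "induced_dist X \<mu> ?u ?v \<le> real (card (med_interval X \<mu> ?u ?v) - 1)"
        using X closed by (intro induced_dist_le joined_single) (auto simp: card_at_most_def)
      also have "\<dots> \<le> K + 1" using at_most unfolding card_at_most_def by linarith
      finally show ?thesis using commute by metis
    qed
    then show "\<exists>\<kappa>\<^sub>4>0. \<forall>a\<in>X. \<forall>b\<in>X. \<forall>c\<in>X. \<forall>e\<in>X.
        induced_dist X \<mu> (\<mu> (\<mu> a b c) b e) (\<mu> a b (\<mu> c b e)) \<le> \<kappa>\<^sub>4"
      using K(1) by (intro exI[of _ "K + 1"]) auto
  qed
qed

end

section \<open>The equivalence\<close>

theorem theorem1p4: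
  fixes X :: "'a set" and \<mu> :: "'a \<Rightarrow> 'a \<Rightarrow> 'a \<Rightarrow> 'a"
  assumes "ternary_algebra X \<mu>"
    and "bounded_valency X \<mu>"
  shows "(coarse_median_algebra X \<mu> \<longleftrightarrow>
            induced_dist_defined X \<mu> \<and> coarse_median_space X (induced_dist X \<mu>) \<mu>) \<and>
         (coarse_median_algebra X \<mu> \<longleftrightarrow>
            (\<exists>d. coarse_median_space X d \<mu> \<and> bounded_geometry_space X d))"
proof -
  have 12: "induced_dist_defined X \<mu> \<and> coarse_median_space X (induced_dist X \<mu>) \<mu>"
    if "coarse_median_algebra X \<mu>"
    using coarse_median_algebra.induced_defined coarse_median_algebra.induced_coarse_median_space
      that assms(2) by blast
  have 23: "bounded_geometry_space X (induced_dist X \<mu>)"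
    if "induced_dist_defined X \<mu>" "coarse_median_space X (induced_dist X \<mu>) \<mu>"
    using symmetric_ternary_algebra.induced_bounded_geometry coarse_median_space.axioms(2) that assms(2)
    by blast
  have 31: "coarse_median_algebra X \<mu>" if "coarse_median_space X d \<mu>" "bounded_geometry_space X d" for d
    using coarse_median_space.bounded_geometry_imp_algebra that by blast
  show ?thesis using 12 23 31 by blast
qed

end
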